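(* Let $\mathcal{D}\subset\mathbb{R}^2$ be a simply connected domain and let $u=(u_1,u_2)^T$ be a smooth vector field on $\mathcal{D}$. If there exists a smooth, positive definite $2\times 2$ matrix function $\mathcal{N}=\mathcal{N}(x)$ on $\mathcal{D}$ with entries $\mathcal{N}_{mn}(x)$, $m,n\in\{1,2\}$, such that the out-of-plane component $\omega$ of $$\mathrm{curl}\,U(x)=\begin{pmatrix}0\\0\\\omega(x)\end{pmatrix},\qquad U(x)=\begin{pmatrix}\mathcal{N}_{11}(x)u_1(x)+\mathcal{N}_{12}(x)u_2(x)\\ \mathcal{N}_{21}(x)u_1(x)+\mathcal{N}_{22}(x)u_2(x)\\0\end{pmatrix},$$ is zero throughout $\mathcal{D}$, then the planar system $\dot{x}=u(x)$ has no closed orbits contained entirely in $\mathcal{D}$.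
   Context: All quantities are real. The matrix $\mathcal{N}(x)$ is not assumed symmetric; positive definite means $v^T\mathcal{N}(x)v>0$ for every nonzero $v\in\mathbb{R}^2$ and every $x\in\mathcal{D}$. In Cartesian coordinates $\mathrm{curl}=\nabla\times$, so that the condition $\omega=0$ reads $\partial U_2/\partial x_1-\partial U_1/\partial x_2=0$. An orbit is a curve in phase space along which a trajectory of the steady system runs; a closed orbit is the closed curve traced by a non-constant periodic trajectory (fixed points are not counted as closed orbits). *)

theory Defs
  imports "HOL-Analysis.Analysis"
begin

(* Ck_on k f S and smooth_on f S are meant for open S: derivatives are taken with respect to the
   whole space.  On a Euclidean space, f is C^(k+1) iff it is Frechet differentiable and all its
   directional derivatives are C^k; this avoids iterating function-space types. *)

primrec Ck_on :: "nat \<Rightarrow> ('a::euclidean_space \<Rightarrow> 'b::real_normed_vector) \<Rightarrow> 'a set \<Rightarrow> bool" where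
  "Ck_on 0 f S \<longleftrightarrow> continuous_on S f"
| "Ck_on (Suc k) f S \<longleftrightarrow>
     (\<forall>x\<in>S. f differentiable (at x)) \<and>
     (\<forall>v. Ck_on k (\<lambda>x. frechet_derivative f (at x) v) S)"

definition smooth_on :: "('a::euclidean_space \<Rightarrow> 'b::real_normed_vector) \<Rightarrow> 'a set \<Rightarrow> bool" where
  "smooth_on f S \<longleftrightarrow> (\<forall>k. Ck_on k f S)"

(* No symmetry of A is required. *)
definition positive_definite :: "real^'n^'n \<Rightarrow> bool" where
  "positive_definite A \<longleftrightarrow> (\<forall>v. v \<noteq> 0 \<longrightarrow> v \<bullet> (A *v v) > 0)"

definition partial_deriv :: "'n \<Rightarrow> (real^'n \<Rightarrow> real) \<Rightarrow> real^'n \<Rightarrow> real" where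
  "partial_deriv i f x = deriv (\<lambda>t. f (x + t *\<^sub>R axis i 1)) 0"

definition curl :: "(real^3 \<Rightarrow> real^3) \<Rightarrow> real^3 \<Rightarrow> real^3" where
  "curl F p = vector
     [partial_deriv 2 (\<lambda>q. F q $ 3) p - partial_deriv 3 (\<lambda>q. F q $ 2) p,
      partial_deriv 3 (\<lambda>q. F q $ 1) p - partial_deriv 1 (\<lambda>q. F q $ 3) p,
      partial_deriv 1 (\<lambda>q. F q $ 2) p - partial_deriv 2 (\<lambda>q. F q $ 1) p]"

(* Curl of a three-component field depending on two coordinates only: the field is regarded as
   constant in the third coordinate. *)
definition planar_curl :: "(real^2 \<Rightarrow> real^3) \<Rightarrow> real^2 \<Rightarrow> real^3" where
  "planar_curl U x = curl (\<lambda>p. U (vector [p $ 1, p $ 2])) (vector [x $ 1, x $ 2, 0])"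

definition weighted_field :: "(real^2 \<Rightarrow> real^2^2) \<Rightarrow> (real^2 \<Rightarrow> real^2) \<Rightarrow> real^2 \<Rightarrow> real^3" where
  "weighted_field N u x = vector
     [N x $ 1 $ 1 * u x $ 1 + N x $ 1 $ 2 * u x $ 2,
      N x $ 2 $ 1 * u x $ 1 + N x $ 2 $ 2 * u x $ 2,
      0]"

lemma planar_curl_weighted_field:
  "planar_curl (weighted_field N u) x = vector
     [0, 0, partial_deriv 1 (\<lambda>y. weighted_field N u y $ 2) x
          - partial_deriv 2 (\<lambda>y. weighted_field N u y $ 1) x]"
proof -
  have 1: "vector [x $ 1 + t, x $ 2] = x + t *\<^sub>R axis 1 1" for t :: real
    by (simp add: vec_eq_iff forall_2 axis_def vector_2)
  have 2: "vector [x $ 1, x $ 2 + t] = x + t *\<^sub>R axis 2 1" for t :: real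
    by (simp add: vec_eq_iff forall_2 axis_def vector_2)
  show ?thesis
    by (simp add: planar_curl_def curl_def partial_deriv_def axis_def vector_3 1[unfolded axis_def]
        2[unfolded axis_def] weighted_field_def[of N u "vector _"] cong: if_cong)
       (simp add: weighted_field_def vector_3)
qed

definition trajectory :: "('a::real_normed_vector \<Rightarrow> 'a) \<Rightarrow> (real \<Rightarrow> 'a) \<Rightarrow> bool" where
  "trajectory u \<phi> \<longleftrightarrow> (\<forall>t. (\<phi> has_vector_derivative u (\<phi> t)) (at t))"

definition closed_orbit :: "('a::real_normed_vector \<Rightarrow> 'a) \<Rightarrow> 'a set \<Rightarrow> bool" where
  "closed_orbit u C \<longleftrightarrow>
     (\<exists>\<phi> T. trajectory u \<phi> \<and> T > 0 \<and> (\<forall>t. \<phi> (t + T) = \<phi> t) \<and>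
            \<not> \<phi> constant_on UNIV \<and> C = range \<phi>)"

end

theory Submission
  imports Defs "HOL-Complex_Analysis.Riemann_Mapping"
begin

text \<open>
  The field \<open>W x = N x *v u x\<close> is curl-free on a simply connected domain, hence a gradient
  \<open>\<nabla>P\<close>; along a trajectory, \<open>P\<close> grows at the rate \<open>u \<bullet> (N *v u)\<close>, which is positive off the fixed
  points, so a periodic trajectory is constant.  The potential exists on starlike domains by
  integration along rays, and on a simply connected planar domain because the Riemann mapping
  theorem pulls the closed form \<open>W \<bullet> dx\<close> back to the unit disc (or the whole plane).
\<close>

section \<open>Potentials of closed forms on starlike open sets\<close>

text \<open>Integrating \<open>B\<close> along the segment from 0 to \<open>z\<close> gives the
  potential. Differentiating under the integral sign in direction \<open>h\<close> yields an
  integrand which, by the symmetry of \<open>B'\<close>, is the derivative of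
  \<open>s * (B (s z) \<bullet> h)\<close> in \<open>s\<close>.\<close>

lemma poincare_lemma_starlike:
  fixes B :: "'a::euclidean_space \<Rightarrow> 'a"
  assumes S: "open S" "\<And>z s. z \<in> S \<Longrightarrow> s \<in> {0..1} \<Longrightarrow> s *\<^sub>R z \<in> S"
    and B: "\<And>z. z \<in> S \<Longrightarrow> (B has_derivative B' z) (at z)"
    and cont: "\<And>h. continuous_on S (\<lambda>z. B' z h)"
    and sym: "\<And>z h k. z \<in> S \<Longrightarrow> B' z h \<bullet> k = B' z k \<bullet> h"
  shows "\<exists>P. \<forall>z\<in>S. (P has_derivative (\<lambda>h. B z \<bullet> h)) (at z)"
proof (intro exI ballI)
  define P where "P z = integral {0..1} (\<lambda>s. B (s *\<^sub>R z) \<bullet> z)" for z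
  \<comment> \<open>The derivative of the integrand in \<open>z\<close>, packaged as a bounded
    linear function because \<open>leibniz_rule\<close> asks for continuity in the operator norm.
    \<open>Blinfun\<close> is meaningful only on linear bounded arguments, so \<open>Q\<close> is
    unfolded only where the segment is known to lie in \<open>S\<close>.\<close>
  define Q where "Q z s = Blinfun (\<lambda>h. s * (B' (s *\<^sub>R z) h \<bullet> z) + B (s *\<^sub>R z) \<bullet> h)" for z s
  fix z assume z: "z \<in> S"
  obtain e where e: "e > 0" "ball z e \<subseteq> S" using S z openE by blast
  \<comment> \<open>A ball, since \<open>leibniz_rule\<close> works on a convex set of
    parameters.\<close>
  define U where "U = ball z e"
  have US: "s *\<^sub>R x \<in> S" if "x \<in> U" "s \<in> {0..1}" for x s
    using that e S(2) by (auto simp: U_def)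
  have lin: "linear (B' x)" if "x \<in> S" for x
    using B[OF that] has_derivative_linear by blast
  have Q: "blinfun_apply (Q x s) = (\<lambda>h. s * (B' (s *\<^sub>R x) h \<bullet> x) + B (s *\<^sub>R x) \<bullet> h)"
    if "x \<in> U" "s \<in> {0..1}" for x s
  proof -
    have "linear (\<lambda>h. s * (B' (s *\<^sub>R x) h \<bullet> x) + B (s *\<^sub>R x) \<bullet> h)"
      using lin[OF US[OF that]]
      by (auto intro!: linearI simp: linear_add linear_scale inner_add_left inner_add_right algebra_simps)
    then show ?thesis
      unfolding Q_def by (intro bounded_linear_Blinfun_apply) (simp add: linear_conv_bounded_linear)
  qed
  have contB: "continuous_on S B"
    using B has_derivative_continuous continuous_at_imp_continuous_on by blast
  have deriv: "((\<lambda>z. B (s *\<^sub>R z) \<bullet> z) has_derivative blinfun_apply (Q x s)) (at x within U)"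
    if "x \<in> U" "s \<in> {0..1}" for x s
  proof -
    have BS: "((\<lambda>z. B (s *\<^sub>R z)) has_derivative (\<lambda>h. B' (s *\<^sub>R x) (s *\<^sub>R h))) (at x within U)"
      by (rule has_derivative_compose[where g = B])
        (use B[OF US[OF that]] in \<open>auto intro!: derivative_eq_intros\<close>)
    show ?thesis
      unfolding Q[OF that]
      by (rule derivative_eq_intros BS | simp)+
        (auto simp: linear_scale[OF lin[OF US[OF that]]] algebra_simps)
  qed
  \<comment> \<open>In finite dimension, norm continuity of operators can be tested on basis
    vectors, so the hypothesis \<open>cont\<close>, with its fixed direction, suffices.\<close>
  have contQ: "continuous_on (U \<times> cbox 0 1) (\<lambda>(x, s). Q x s)"
  proof (rule continuous_on_blinfun_componentwise)
    fix i :: 'a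
    have "continuous_on (U \<times> cbox 0 1)
        (\<lambda>p. snd p * (B' (snd p *\<^sub>R fst p) i \<bullet> fst p) + B (snd p *\<^sub>R fst p) \<bullet> i)"
      using US by (auto intro!: continuous_intros continuous_on_compose2[OF cont]
          continuous_on_compose2[OF contB])
    then show "continuous_on (U \<times> cbox 0 1) (\<lambda>x. blinfun_apply (case x of (x, s) \<Rightarrow> Q x s) i)"
      by (rule continuous_on_eq) (auto simp: Q)
  qed
  have "((\<lambda>x. integral (cbox 0 1) (\<lambda>s. B (s *\<^sub>R x) \<bullet> x)) has_derivative
      blinfun_apply (integral (cbox 0 1) (Q z))) (at z within U)"
  proof (rule leibniz_rule[OF _ _ contQ])
    show "(\<lambda>s. B (s *\<^sub>R x) \<bullet> x) integrable_on cbox 0 1" if "x \<in> U" for x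
      using US[OF that]
      by (intro integrable_continuous) (auto intro!: continuous_intros continuous_on_compose2[OF contB])
  qed (use deriv e in \<open>auto simp: U_def\<close>)
  moreover have zU: "z \<in> U" using e by (simp add: U_def)
  moreover have "blinfun_apply (integral (cbox 0 1) (Q z)) h = B z \<bullet> h" for h
  proof -
    have "continuous_on {0..1} (\<lambda>s. case (z, s) of (x, s) \<Rightarrow> Q x s)"
      by (rule continuous_on_compose2[OF contQ]) (auto intro!: continuous_intros zU)
    then have "continuous_on {0..1} (Q z)"
      by simp
    then have "(Q z) integrable_on {0..1}"
      by (rule integrable_continuous_real)
    then have "blinfun_apply (integral {0..1} (Q z)) h = integral {0..1} (\<lambda>s. blinfun_apply (Q z s) h)"
      by (rule blinfun_apply_integral)
    \<comment> \<open>Symmetry moves \<open>h\<close> out of \<open>B'\<close> and \<open>z\<close>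
      into it. Now \<open>B'\<close> is applied to the radial direction, which makes the integrand
      an exact derivative in \<open>s\<close>.\<close>
    also have "\<dots> = integral {0..1} (\<lambda>s. s * (B' (s *\<^sub>R z) z \<bullet> h) + B (s *\<^sub>R z) \<bullet> h)"
      by (rule integral_cong) (simp add: Q zU sym[OF US[OF zU], of _ h])
    also have "\<dots> = B z \<bullet> h"
    proof -
      have "((\<lambda>s. s * (B' (s *\<^sub>R z) z \<bullet> h) + B (s *\<^sub>R z) \<bullet> h) has_integral
          1 * (B (1 *\<^sub>R z) \<bullet> h) - 0 * (B (0 *\<^sub>R z) \<bullet> h)) {0..1}"
      proof (rule fundamental_theorem_of_calculus)
        fix s :: real assume s: "s \<in> {0..1}"
        have BS: "((\<lambda>s. B (s *\<^sub>R z)) has_derivative (\<lambda>t. B' (s *\<^sub>R z) (t *\<^sub>R z))) (at s within {0..1})"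
          by (rule has_derivative_compose[where g = B])
            (use B[OF US[OF zU s]] in \<open>auto intro!: derivative_eq_intros\<close>)
        show "((\<lambda>s. s * (B (s *\<^sub>R z) \<bullet> h)) has_vector_derivative
            s * (B' (s *\<^sub>R z) z \<bullet> h) + B (s *\<^sub>R z) \<bullet> h) (at s within {0..1})"
          unfolding has_vector_derivative_def
          by (rule derivative_eq_intros BS | simp)+
            (auto simp: linear_scale[OF lin[OF US[OF zU s]]] algebra_simps)
      qed simp
      then show ?thesis by (simp add: integral_unique)
    qed
    finally show ?thesis by simp
  qed
  then have "blinfun_apply (integral (cbox 0 1) (Q z)) = (\<lambda>h. B z \<bullet> h)"
    by blast
  ultimately show "(P has_derivative (\<lambda>h. B z \<bullet> h)) (at z)"
    using at_within_open[OF zU] by (simp add: P_def[abs_def] U_def)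
qed

section \<open>Closed forms on simply connected planar domains\<close>

text \<open>The whole plane is starlike. Otherwise a nonempty \<open>D\<close> is biholomorphic to
  the unit disc: the form is pulled back along \<open>g\<close>, a potential is found on the disc,
  and composing it with \<open>f\<close> brings it back to \<open>D\<close>.\<close>

lemma poincare_lemma_complex:
  fixes A :: "complex \<Rightarrow> complex"
  assumes D: "open D" "simply_connected D"
    and A: "\<And>z. z \<in> D \<Longrightarrow> (A has_derivative A' z) (at z)"
    and cont: "\<And>h. continuous_on D (\<lambda>z. A' z h)"
    and sym: "\<And>z h k. z \<in> D \<Longrightarrow> A' z h \<bullet> k = A' z k \<bullet> h"
  shows "\<exists>P. \<forall>z\<in>D. (P has_derivative (\<lambda>h. A z \<bullet> h)) (at z)"
proof -
  consider "D = {}" | "D = UNIV" | f g where "f holomorphic_on D" "g holomorphic_on ball 0 1"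
      "\<And>z. z \<in> D \<Longrightarrow> f z \<in> ball 0 1 \<and> g (f z) = z"
      "\<And>z. z \<in> ball 0 1 \<Longrightarrow> g z \<in> D"
    using simply_connected_eq_biholomorphic_to_disc[OF D(1)] D(2) by blast
  then show ?thesis
  proof cases
    case 1
    then show ?thesis by simp
  next
    case 2
    show ?thesis
      by (rule poincare_lemma_starlike[OF D(1) _ A cont sym]) (simp_all add: 2)
  next
    case 3
    define S where "S = ball (0::complex) 1"
    \<comment> \<open>the pullback under \<open>g\<close>: \<open>B z \<bullet> h = A (g z) \<bullet> (deriv g z * h)\<close>\<close>
    define B where "B z = cnj (deriv g z) * A (g z)" for z
    define B' where "B' z h = cnj (deriv (deriv g) z * h) * A (g z)
        + cnj (deriv g z) * A' (g z) (deriv g z * h)" for z h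
    have S: "open S" "\<And>z. z \<in> S \<Longrightarrow> g z \<in> D" using 3 by (auto simp: S_def)
    have hol: "g holomorphic_on S" "deriv g holomorphic_on S" "deriv (deriv g) holomorphic_on S"
      using 3 S by (auto simp: S_def intro!: holomorphic_deriv)
    have dg: "(g has_derivative (\<lambda>h. deriv g z * h)) (at z)"
      "(deriv g has_derivative (\<lambda>h. deriv (deriv g) z * h)) (at z)" if "z \<in> S" for z
      using holomorphic_derivI[OF hol(1) S(1) that] holomorphic_derivI[OF hol(2) S(1) that]
      by (simp_all add: has_field_derivative_def)
    have lin: "linear (A' z)" if "z \<in> D" for z
      using A[OF that] has_derivative_linear by blast
    \<comment> \<open>\<open>cont\<close> concerns one fixed direction, while in \<open>B'\<close>
      the direction \<open>deriv g z * h\<close> moves with \<open>z\<close>. Expanding in the real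
      basis 1, \<i> leaves only fixed directions.\<close>
    have A'_eq: "A' z h = Re h *\<^sub>R A' z 1 + Im h *\<^sub>R A' z \<i>" if "z \<in> D" for z h
    proof -
      have "h = Re h *\<^sub>R 1 + Im h *\<^sub>R \<i>" by (simp add: complex_eq_iff)
      then show ?thesis
        using linear_add[OF lin[OF that]] linear_scale[OF lin[OF that]] by metis
    qed
    have contA: "continuous_on D A"
      using A has_derivative_continuous continuous_at_imp_continuous_on by blast
    note hc = hol[THEN holomorphic_on_imp_continuous_on]
    have "\<exists>P. \<forall>z\<in>S. (P has_derivative (\<lambda>h. B z \<bullet> h)) (at z)"
    proof (rule poincare_lemma_starlike[of S B B'])
      show "open S" by fact
      show "s *\<^sub>R z \<in> S" if "z \<in> S" "s \<in> {0..1}" for z s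
        using that mult_left_le_one_le[of "cmod z" s] by (auto simp: S_def)
      show "(B has_derivative B' z) (at z)" if z: "z \<in> S" for z
        unfolding B_def[abs_def] B'_def
        by (rule derivative_eq_intros dg[OF z] bounded_linear.has_derivative[OF bounded_linear_cnj]
            has_derivative_compose[OF dg(1)[OF z] A[OF S(2)[OF z]]] | simp add: algebra_simps)+
      show "continuous_on S (\<lambda>z. B' z h)" for h
      proof -
        have "continuous_on S (\<lambda>z. cnj (deriv (deriv g) z * h) * A (g z) + cnj (deriv g z) *
           (Re (deriv g z * h) *\<^sub>R A' (g z) 1 + Im (deriv g z * h) *\<^sub>R A' (g z) \<i>))"
          using S by (intro continuous_intros hc continuous_on_compose2[OF contA hc(1)]
              continuous_on_compose2[OF cont hc(1)]) auto
        then show ?thesis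
          by (rule continuous_on_eq) (simp add: B'_def A'_eq[OF S(2), of _ "deriv g _ * h"])
      qed
      show "B' z h \<bullet> k = B' z k \<bullet> h" if z: "z \<in> S" for z h k
      proof -
        \<comment> \<open>Multiplication by \<open>cnj a\<close> is the adjoint of multiplication by
          \<open>a\<close>. Hence the term with the second derivative of \<open>g\<close> is
          symmetric by commutativity of the product \<open>h * k\<close>, and the other term by
          \<open>sym\<close>.\<close>
        have c: "(cnj a * b) \<bullet> c = b \<bullet> (a * c)" for a b c :: complex
          by (simp add: inner_complex_def algebra_simps)
        have "B' z h \<bullet> k = A (g z) \<bullet> (deriv (deriv g) z * h * k)
            + A' (g z) (deriv g z * h) \<bullet> (deriv g z * k)" for h k
          unfolding B'_def inner_add_left c ..
        then show ?thesis
          using sym[OF S(2)[OF z]] by (simp add: mult_ac)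
      qed
    qed
    then obtain P where P: "\<And>z. z \<in> S \<Longrightarrow> (P has_derivative (\<lambda>h. B z \<bullet> h)) (at z)"
      by blast
    show ?thesis
    proof (intro exI ballI)
      fix z assume z: "z \<in> D"
      have df: "(f has_derivative (\<lambda>h. deriv f z * h)) (at z)"
        using holomorphic_derivI[OF 3(1) D(1) z] by (simp add: has_field_derivative_def)
      have fz: "f z \<in> S" using 3 z by (auto simp: S_def)
      \<comment> \<open>Differentiating \<open>g (f z) = z\<close> in two ways shows that the
        derivatives of \<open>g\<close> and \<open>f\<close> cancel, so pulling back along
        \<open>f\<close> undoes the pullback along \<open>g\<close>.\<close>
      have "((\<lambda>z. g (f z)) has_derivative (\<lambda>h. deriv g (f z) * (deriv f z * h))) (at z)"
        by (rule has_derivative_compose[OF df dg(1)[OF fz]])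
      moreover have "((\<lambda>z. g (f z)) has_derivative (\<lambda>h. h)) (at z)"
        by (rule has_derivative_transform_within_open[OF has_derivative_ident D(1) z]) (simp add: 3)
      ultimately have gf: "deriv g (f z) * (deriv f z * h) = h" for h
        using has_derivative_unique by metis
      have "B (f z) \<bullet> (deriv f z * h) = A z \<bullet> h" for h
      proof -
        have "B (f z) \<bullet> (deriv f z * h) = A z \<bullet> (deriv g (f z) * (deriv f z * h))"
          using 3(3)[OF z] by (simp add: B_def inner_complex_def algebra_simps)
        then show ?thesis by (simp add: gf)
      qed
      then show "((\<lambda>z. P (f z)) has_derivative (\<lambda>h. A z \<bullet> h)) (at z)"
        using has_derivative_compose[OF df P[OF fz]] by simp
    qed
  qed
qed
text \<open>The coordinate maps \<open>d\<close> and \<open>c\<close> are mutually inverse linear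
  isometries, so openness, simple connectedness, closedness of the form and its potential all
  transfer between the real plane and the complex numbers.\<close>

lemma poincare_lemma_plane:
  fixes W :: "real^2 \<Rightarrow> real^2"
  assumes D: "open D" "simply_connected D"
    and W: "\<And>x. x \<in> D \<Longrightarrow> (W has_derivative W' x) (at x)"
    and cont: "\<And>h. continuous_on D (\<lambda>x. W' x h)"
    and sym: "\<And>x h k. x \<in> D \<Longrightarrow> W' x h \<bullet> k = W' x k \<bullet> h"
  shows "\<exists>P. \<forall>x\<in>D. (P has_derivative (\<lambda>h. W x \<bullet> h)) (at x)"
proof -
  define d :: "real^2 \<Rightarrow> complex" where "d x = Complex (x $ 1) (x $ 2)" for x
  define c :: "complex \<Rightarrow> real^2" where "c z = vector [Re z, Im z]" for z
  have cd [simp]: "c (d x) = x" "d (c z) = z" for x z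
    by (simp_all add: c_def d_def vec_eq_iff forall_2 complex_eq_iff)
  have lin: "linear d" "linear c"
    by (auto intro!: linearI simp: d_def c_def complex_eq_iff vec_eq_iff forall_2)
  then have bl: "bounded_linear d" "bounded_linear c"
    by (simp_all add: linear_conv_bounded_linear)
  have inner_d: "d x \<bullet> z = x \<bullet> c z" for x z
    by (simp add: d_def c_def inner_complex_def inner_vec_def sum_2)
  have inj: "inj d" by (metis cd(1) injI)
  have D': "c z \<in> D \<longleftrightarrow> z \<in> d ` D" for z
    by (metis cd image_iff)
  have "d ` D = c -` D"
    using D' by auto
  then have op: "open (d ` D)"
    using D(1) bl(2) by (simp add: linear_continuous_on open_vimage)
  have sc: "simply_connected (d ` D)"
    using homeomorphic_simply_connected[OF linear_homeomorphic_image[OF lin(1) inj] D(2)] .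
  have "\<exists>P. \<forall>z \<in> d ` D. (P has_derivative (\<lambda>h. d (W (c z)) \<bullet> h)) (at z)"
  proof (rule poincare_lemma_complex[OF op sc, of "\<lambda>z. d (W (c z))" "\<lambda>z h. d (W' (c z) (c h))"])
    show "((\<lambda>z. d (W (c z))) has_derivative (\<lambda>h. d (W' (c z) (c h)))) (at z)" if "z \<in> d ` D" for z
      by (rule bounded_linear.has_derivative[OF bl(1)]
          has_derivative_compose[OF bounded_linear_imp_has_derivative[OF bl(2)]] W)+
        (use that in \<open>simp add: D'\<close>)
    show "continuous_on (d ` D) (\<lambda>z. d (W' (c z) (c h)))" for h
      by (intro bounded_linear.continuous_on[OF bl(1)] continuous_on_compose2[OF cont]
          linear_continuous_on[OF bl(2)]) (simp add: image_subset_iff)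
    show "d (W' (c z) (c h)) \<bullet> k = d (W' (c z) (c k)) \<bullet> h" if "z \<in> d ` D" for z h k
      using that sym[of "c z" "c h" "c k"] by (simp add: inner_d D')
  qed
  then obtain P where P: "\<And>z. z \<in> d ` D \<Longrightarrow> (P has_derivative (\<lambda>h. d (W (c z)) \<bullet> h)) (at z)"
    by blast
  show ?thesis
  proof (intro exI ballI)
    fix x assume "x \<in> D"
    then have "((\<lambda>x. P (d x)) has_derivative (\<lambda>h. d (W (c (d x))) \<bullet> d h)) (at x)"
      by (intro has_derivative_compose[OF bounded_linear_imp_has_derivative[OF bl(1)]] P) simp
    then show "((\<lambda>x. P (d x)) has_derivative (\<lambda>h. W x \<bullet> h)) (at x)"
      by (simp add: inner_d)
  qed
qed

section \<open>Calculus for the weighted field\<close>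

lemma smooth_onD:
  assumes "smooth_on f S"
  shows "x \<in> S \<Longrightarrow> (f has_derivative frechet_derivative f (at x)) (at x)"
    and "continuous_on S (\<lambda>x. frechet_derivative f (at x) v)"
    and "continuous_on S f"
proof -
  have "Ck_on 0 f S" "Ck_on (Suc 0) f S"
    using assms unfolding smooth_on_def by blast+
  then show "x \<in> S \<Longrightarrow> (f has_derivative frechet_derivative f (at x)) (at x)"
    and "continuous_on S (\<lambda>x. frechet_derivative f (at x) v)"
    and "continuous_on S f"
    using frechet_derivative_works by auto
qed

text \<open>The chain rule along the line through \<open>x\<close> in direction
  \<open>axis i 1\<close>. It turns the one-variable derivatives inside \<open>curl\<close> into
  entries of the Jacobian matrix.\<close>

lemma partial_deriv_component:
  fixes f :: "real^'n \<Rightarrow> real^'m"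
  assumes "(f has_derivative f') (at x)"
  shows "partial_deriv i (\<lambda>y. f y $ j) x = f' (axis i 1) $ j"
proof -
  have "((\<lambda>t. x + t *\<^sub>R axis i 1) has_derivative (\<lambda>t. t *\<^sub>R axis i 1)) (at 0)"
    by (auto intro!: derivative_eq_intros)
  then have "((\<lambda>t. f (x + t *\<^sub>R axis i 1)) has_derivative (\<lambda>t. f' (t *\<^sub>R axis i 1))) (at 0)"
    by (rule has_derivative_compose) (use assms in simp)
  then have "((\<lambda>t. f (x + t *\<^sub>R axis i 1) $ j) has_derivative (\<lambda>t. f' (t *\<^sub>R axis i 1) $ j)) (at 0)"
    by (rule bounded_linear.has_derivative[OF bounded_linear_vec_nth])
  moreover have "f' (t *\<^sub>R axis i 1) $ j = f' (axis i 1) $ j * t" for t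
    using linear_scale[OF has_derivative_linear[OF assms], of t "axis i 1"] by simp
  ultimately show ?thesis
    unfolding partial_deriv_def by (intro DERIV_imp_deriv) (simp add: has_field_derivative_def)
qed

text \<open>Supplies the product rule for \<open>N x *v u x\<close> and the continuity of the
  resulting derivative.\<close>

lemma bounded_bilinear_matrix_vector_mult:
  "bounded_bilinear ((*v) :: real^'n^'m \<Rightarrow> real^'n \<Rightarrow> real^'m)"
  unfolding bilinear_conv_bounded_bilinear[symmetric] bilinear_def
  by (auto intro!: linearI simp: matrix_vector_mult_add_rdistrib matrix_vector_right_distrib
      scaleR_matrix_vector_assoc matrix_vector_mult_scaleR)

section \<open>The potential along a periodic trajectory\<close>

theorem theorem2:
  fixes D :: "(real^2) set" and u :: "real^2 \<Rightarrow> real^2"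
  assumes "open D" and "connected D" and "D \<noteq> {}" and "simply_connected D"
    and "smooth_on u D"
    and "\<exists>N :: real^2 \<Rightarrow> real^2^2.
           smooth_on N D \<and> (\<forall>x\<in>D. positive_definite (N x)) \<and>
           (\<forall>x\<in>D. planar_curl (weighted_field N u) x $ 3 = 0)"
  shows "\<not> (\<exists>C. closed_orbit u C \<and> C \<subseteq> D)"
proof
  assume "\<exists>C. closed_orbit u C \<and> C \<subseteq> D"
  then obtain \<phi> T where \<phi>: "\<And>t. (\<phi> has_vector_derivative u (\<phi> t)) (at t)"
    and T: "T > 0" "\<And>t. \<phi> (t + T) = \<phi> t" and nconst: "\<not> \<phi> constant_on UNIV"
    and ran: "\<And>t. \<phi> t \<in> D"
    unfolding closed_orbit_def trajectory_def by blast
  obtain N :: "real^2 \<Rightarrow> real^2^2" where N: "smooth_on N D"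
    and pd: "\<And>x. x \<in> D \<Longrightarrow> positive_definite (N x)"
    and curl: "\<And>x. x \<in> D \<Longrightarrow> planar_curl (weighted_field N u) x $ 3 = 0"
    using assms(6) by blast
  note u = smooth_onD[OF assms(5)] and N = smooth_onD[OF N]
  define W where "W x = N x *v u x" for x
  define W' where "W' x h = N x *v frechet_derivative u (at x) h + frechet_derivative N (at x) h *v u x" for x h
  have W: "(W has_derivative W' x) (at x)" if "x \<in> D" for x
    unfolding W_def[abs_def] W'_def[abs_def]
    by (rule bounded_bilinear.FDERIV[OF bounded_bilinear_matrix_vector_mult N(1)[OF that] u(1)[OF that]])
  have "\<exists>P. \<forall>x\<in>D. (P has_derivative (\<lambda>h. W x \<bullet> h)) (at x)"
  proof (rule poincare_lemma_plane[OF assms(1,4) W])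
    show "continuous_on D (\<lambda>x. W' x h)" for h
      unfolding W'_def
      by (intro continuous_on_add bounded_bilinear.continuous_on[OF bounded_bilinear_matrix_vector_mult] u N)
    show "W' x h \<bullet> k = W' x k \<bullet> h" if x: "x \<in> D" for x h k
    proof -
      have "weighted_field N u y $ 1 = W y $ 1" "weighted_field N u y $ 2 = W y $ 2" for y
        by (simp_all add: weighted_field_def W_def matrix_vector_mult_def sum_2)
      \<comment> \<open>In two dimensions the Jacobian matrix has a single off-diagonal pair, so
        vanishing of the third curl component is exactly its symmetry. Expanding \<open>h\<close>
        and \<open>k\<close> in coordinates extends this to all directions.\<close>
      then have eq: "W' x (axis 1 1) $ 2 = W' x (axis 2 1) $ 1"
        using curl[OF x] by (simp add: planar_curl_weighted_field partial_deriv_component[OF W[OF x]])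
      have expand: "W' x h = h $ 1 *\<^sub>R W' x (axis 1 1) + h $ 2 *\<^sub>R W' x (axis 2 1)" for h
      proof -
        have "h = h $ 1 *\<^sub>R axis 1 1 + h $ 2 *\<^sub>R axis 2 1"
          by (simp add: vec_eq_iff forall_2 axis_def)
        then have "W' x h = W' x (h $ 1 *\<^sub>R axis 1 1 + h $ 2 *\<^sub>R axis 2 1)"
          by (rule arg_cong)
        then show ?thesis
          using has_derivative_linear[OF W[OF x]] by (simp only: linear_add linear_scale)
      qed
      show ?thesis
        by (simp add: expand[of h] expand[of k] inner_vec_def sum_2 eq algebra_simps)
    qed
  qed
  then obtain P where P: "\<And>x. x \<in> D \<Longrightarrow> (P has_derivative (\<lambda>h. W x \<bullet> h)) (at x)"
    by blast
  define p where "p t = P (\<phi> t)" for t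
  have p: "(p has_real_derivative W (\<phi> t) \<bullet> u (\<phi> t)) (at t)" for t
  proof -
    have "((\<lambda>t. P (\<phi> t)) has_derivative (\<lambda>s. W (\<phi> t) \<bullet> (s *\<^sub>R u (\<phi> t)))) (at t)"
      by (rule has_derivative_compose[OF \<phi>[unfolded has_vector_derivative_def] P[OF ran]])
    then show ?thesis
      by (simp add: p_def[abs_def] has_field_derivative_def mult_commute_abs)
  qed
  have pos: "W (\<phi> t) \<bullet> u (\<phi> t) > 0" if "u (\<phi> t) \<noteq> 0" for t
    using pd[OF ran[of t]] that by (auto simp: positive_definite_def W_def inner_commute)
  \<comment> \<open>At a point where \<open>u\<close> vanishes the rate \<open>W \<bullet> u\<close>
    is 0; elsewhere it is positive by \<open>pos\<close>.\<close>
  have mono: "p s \<le> p t" if "s \<le> t" for s t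
  proof (rule DERIV_nonneg_imp_nondecreasing[OF that])
    show "\<exists>y. (p has_real_derivative y) (at x) \<and> 0 \<le> y" for x
      using p[of x] pos[of x] by (cases "u (\<phi> x) = 0") force+
  qed
  have per: "p (t + of_nat n * T) = p t" for t n
  proof (induction n)
    case (Suc n)
    then show ?case
      using T(2)[of "t + of_nat n * T"] by (simp add: p_def algebra_simps)
  qed simp
  have const: "p s = p t" if "s \<le> t" for s t
  proof -
    \<comment> \<open>Choose enough periods to pass \<open>t\<close>: then
      \<open>p s \<le> p t \<le> p (s + n T) = p s\<close>.\<close>
    obtain n where "t - s \<le> of_nat n * T"
      using reals_Archimedean3[OF T(1)] less_imp_le by blast
    then show ?thesis
      using mono[of t "s + of_nat n * T"] mono[OF that] by (simp add: per)
  qed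
  have "p t = p 0" for t
    using const[of t 0] const[of 0 t] by linarith
  then have "p = (\<lambda>_. p 0)"
    by blast
  then have "(p has_real_derivative 0) (at t)" for t
    by (metis DERIV_const)
  \<comment> \<open>The growth rate of the constant \<open>p\<close> is 0. By positive definiteness
    every point of the trajectory is then a fixed point, so \<phi> has zero derivative and is
    constant, against the definition of a closed orbit.\<close>
  then have "W (\<phi> t) \<bullet> u (\<phi> t) = 0" for t
    using DERIV_unique[OF p] by blast
  then have "u (\<phi> t) = 0" for t
    using pos[of t] by force
  then have "(\<phi> has_derivative (\<lambda>_. 0)) (at t)" for t
    using \<phi>[of t] by (simp add: has_vector_derivative_def)
  then have "\<phi> constant_on UNIV"
    using has_derivative_zero_constant[of UNIV \<phi>] by (auto simp: constant_on_def)
  with nconst show False by simp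
qed

end
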